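(* Let $H$ be a connected graph with $\gamma_{r2}(H)=3$ such that for every $2$-rainbow dominating function $\varphi$ of $H$ of minimum weight, $\varphi(h)\ne\{1,2\}$ for every vertex $h$ of $H$. Then for any graph $G$, \[\gamma_{r2}(G\circ H)=\min\{\,2|A|+3|B| \;:\; (A,B) \text{ is a dominating couple of } G\,\}.\]
   Context: All graphs are finite and simple. A $2$-rainbow dominating function of a graph $X$ is a map $f\colon V(X)\to 2^{\{1,2\}}$ such that for every vertex $v$ with $f(v)=\emptyset$ we have $\bigcup_{u\in N(v)} f(u)=\{1,2\}$; its weight is $\sum_v |f(v)|$, and $\gamma_{r2}(X)$ is the minimum weight of such a function. The lexicographic product $G\circ H$ has vertex set $V(G)\times V(H)$, with $(g_1,h_1)$ adjacent to $(g_2,h_2)$ iff $g_1g_2\in E(G)$, or $g_1=g_2$ and $h_1h_2\in E(H)$. An ordered pair $(A,B)$ of disjoint subsets $A,B\subseteq V(G)$ is a dominating couple of $G$ if for every vertex $x\in V(G)\setminus B$ there is a vertex $w\in A\cup B$ with $x\in N_G(w)$. *)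

theory Defs
  imports "Graph_Theory.Graph_Theory"
begin

text \<open>
  A finite simple graph is a \<^term>\<open>pair_graph\<close>: a finite, loop-free digraph
  whose arc relation \<^term>\<open>parcs\<close> is symmetric, so that an edge \<open>uv\<close> is
  represented by the two arcs \<open>(u, v)\<close> and \<open>(v, u)\<close>. The vertex set may be empty.
\<close>

definition neighbourhood :: "'a pair_pre_digraph \<Rightarrow> 'a \<Rightarrow> 'a set" where
  "neighbourhood X v = {u. (v, u) \<in> parcs X}"

definition two_rainbow_dominating :: "'a pair_pre_digraph \<Rightarrow> ('a \<Rightarrow> nat set) \<Rightarrow> bool" where
  "two_rainbow_dominating X f \<longleftrightarrow>
     (\<forall>v\<in>pverts X. f v \<subseteq> {1, 2}) \<and>
     (\<forall>v\<in>pverts X. f v = {} \<longrightarrow> (\<Union>u\<in>neighbourhood X v. f u) = {1, 2})"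

definition rainbow_weight :: "'a pair_pre_digraph \<Rightarrow> ('a \<Rightarrow> nat set) \<Rightarrow> nat" where
  "rainbow_weight X f = (\<Sum>v\<in>pverts X. card (f v))"

definition two_rainbow_domination_number :: "'a pair_pre_digraph \<Rightarrow> nat" where
  "two_rainbow_domination_number X = Min {rainbow_weight X f |f. two_rainbow_dominating X f}"

definition lex_product ::
  "'a pair_pre_digraph \<Rightarrow> 'b pair_pre_digraph \<Rightarrow> ('a \<times> 'b) pair_pre_digraph" where
  "lex_product G H =
     \<lparr> pverts = pverts G \<times> pverts H,
       parcs = {((g1, h1), (g2, h2)) |g1 h1 g2 h2.
         g1 \<in> pverts G \<and> g2 \<in> pverts G \<and> h1 \<in> pverts H \<and> h2 \<in> pverts H \<and>
         ((g1, g2) \<in> parcs G \<or> g1 = g2 \<and> (h1, h2) \<in> parcs H)} \<rparr>"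

definition dominating_couple :: "'a pair_pre_digraph \<Rightarrow> 'a set \<Rightarrow> 'a set \<Rightarrow> bool" where
  "dominating_couple G A B \<longleftrightarrow>
     A \<subseteq> pverts G \<and> B \<subseteq> pverts G \<and> A \<inter> B = {} \<and>
     (\<forall>x\<in>pverts G - B. \<exists>w\<in>A \<union> B. x \<in> neighbourhood G w)"

lemma pair_graph_lex_product:
  assumes "pair_graph G" and "pair_graph H"
  shows "pair_graph (lex_product G H)"
proof -
  interpret G: pair_graph G by fact
  interpret H: pair_graph H by fact
  have sG: "\<And>u v. (u, v) \<in> parcs G \<Longrightarrow> (v, u) \<in> parcs G"
    using G.pair_sym_arcs by (auto simp: symmetric_def dest: symD)
  have sH: "\<And>u v. (u, v) \<in> parcs H \<Longrightarrow> (v, u) \<in> parcs H"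
    using H.pair_sym_arcs by (auto simp: symmetric_def dest: symD)
  have "parcs (lex_product G H) \<subseteq> pverts (lex_product G H) \<times> pverts (lex_product G H)"
    by (auto simp: lex_product_def)
  moreover have "finite (pverts (lex_product G H))"
    by (simp add: lex_product_def G.pair_finite_verts H.pair_finite_verts)
  ultimately have fin: "finite (parcs (lex_product G H))"
    by (meson finite_SigmaI finite_subset)
  show ?thesis
    using fin G.pair_no_loops H.pair_no_loops sG sH
    by unfold_locales
      (auto simp: lex_product_def symmetric_def G.pair_finite_verts H.pair_finite_verts
        intro!: symI)
qed

text \<open>The sets of weights and of couple costs are finite and nonempty, so that \<^term>\<open>Min\<close> is an attained minimum.\<close>

lemma finite_rainbow_weights:
  assumes "finite (pverts X)"
  shows "finite {rainbow_weight X f |f. two_rainbow_dominating X f}"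
proof (rule finite_subset)
  show "{rainbow_weight X f |f. two_rainbow_dominating X f} \<subseteq> {..2 * card (pverts X)}"
  proof clarsimp
    fix f assume f: "two_rainbow_dominating X f"
    have "card (f v) \<le> 2" if "v \<in> pverts X" for v
    proof -
      have "f v \<subseteq> {1, 2}" using f that by (simp add: two_rainbow_dominating_def)
      then have "card (f v) \<le> card {1, 2 :: nat}" by (intro card_mono) auto
      then show ?thesis by simp
    qed
    then show "rainbow_weight X f \<le> 2 * card (pverts X)"
      using sum_bounded_above[of "pverts X" "\<lambda>v. card (f v)" 2]
      by (simp add: rainbow_weight_def mult.commute)
  qed
qed simp

lemma rainbow_weights_nonempty: "{rainbow_weight X f |f. two_rainbow_dominating X f} \<noteq> {}"
proof -
  have "two_rainbow_dominating X (\<lambda>_. {1, 2})" by (simp add: two_rainbow_dominating_def)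
  then show ?thesis by blast
qed

lemma finite_couple_costs:
  assumes "finite (pverts G)"
  shows "finite {2 * card A + 3 * card B |A B. dominating_couple G A B}"
proof (rule finite_subset)
  show "{2 * card A + 3 * card B |A B. dominating_couple G A B}
      \<subseteq> (\<lambda>(A, B). 2 * card A + 3 * card B) ` (Pow (pverts G) \<times> Pow (pverts G))"
    by (force simp: dominating_couple_def)
qed (use assms in auto)

lemma couple_costs_nonempty: "{2 * card A + 3 * card B |A B. dominating_couple G A B} \<noteq> {}"
proof -
  have "dominating_couple G {} (pverts G)" by (simp add: dominating_couple_def)
  then show ?thesis by blast
qed

end

theory Submission
  imports Defs
begin

text \<open>
  Upper bound: put a minimum function of \<open>H\<close> on every layer over \<open>B\<close> and the label set
  \<open>{1, 2}\<close> on one vertex of every layer over \<open>A\<close>.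

  Lower bound: let \<open>w g\<close> and \<open>L g\<close> be the weight and the set of labels of the layer over \<open>g\<close>.
  If no neighbouring layer carries the label \<open>k\<close>, the hypothesis on \<open>H\<close> forces \<open>w g \<ge> 3\<close>, or
  \<open>w g = 2\<close> and \<open>L g = {k}\<close>. For each label \<open>k\<close> one gets a dominating couple: \<open>B\<close> contains the
  layers of weight at least 3, \<open>A\<close> those of weight 2 and those of weight 1 with label \<open>k\<close>, except
  that a layer of weight 2 with \<open>L g = {l}\<close> and only neighbours of weight at most 1 goes into \<open>B\<close>
  if \<open>l = k\<close> and is discarded otherwise. The costs of the two couples add up to at most twice the
  weight of the function, so one of them is cheap enough.
\<close>

section \<open>Basic facts on graphs and 2-rainbow dominating functions\<close>

lemma pair_graph_arc_sym:
  assumes "pair_graph X" "(u, v) \<in> parcs X"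
  shows "(v, u) \<in> parcs X"
proof -
  interpret pair_graph X by fact
  show ?thesis using assms(2) pair_sym_arcs by (auto simp: symmetric_def dest: symD)
qed

lemma pair_graph_arc_verts:
  assumes "pair_graph X" "(u, v) \<in> parcs X"
  shows "u \<in> pverts X" "v \<in> pverts X"
proof -
  interpret pair_graph X by fact
  show "u \<in> pverts X" "v \<in> pverts X" using assms(2) in_arcsD1 in_arcsD2 by blast+
qed

lemma pair_graph_finite_verts:
  assumes "pair_graph X"
  shows "finite (pverts X)"
proof -
  interpret pair_graph X by fact
  show ?thesis by (rule pair_finite_verts)
qed

lemma two_rainbow_domination_number_le:
  assumes "pair_graph X" "two_rainbow_dominating X f"
  shows "two_rainbow_domination_number X \<le> rainbow_weight X f"
  unfolding two_rainbow_domination_number_def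
  by (rule Min_le[OF finite_rainbow_weights[OF pair_graph_finite_verts]]) (use assms in auto)

lemma two_rainbow_domination_number_attained:
  assumes "pair_graph X"
  obtains f where "two_rainbow_dominating X f"
    "rainbow_weight X f = two_rainbow_domination_number X"
  using Min_in[OF finite_rainbow_weights[OF pair_graph_finite_verts[OF assms]]
      rainbow_weights_nonempty]
  unfolding two_rainbow_domination_number_def by auto

text \<open>Splits the union condition into one neighbour per label, the form in which witnesses
  arise; the reverse inclusion is automatic since arcs end in vertices.\<close>

lemma two_rainbow_dominatingI:
  assumes "pair_graph X" "\<And>v. v \<in> pverts X \<Longrightarrow> f v \<subseteq> {1, 2}"
    "\<And>v k. \<lbrakk>v \<in> pverts X; f v = {}; k \<in> {1, 2}\<rbrakk> \<Longrightarrow> \<exists>u. (v, u) \<in> parcs X \<and> k \<in> f u"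
  shows "two_rainbow_dominating X f"
  unfolding two_rainbow_dominating_def neighbourhood_def
proof (intro conjI ballI impI)
  fix v assume v: "v \<in> pverts X" "f v = {}"
  show "(\<Union>u\<in>{u. (v, u) \<in> parcs X}. f u) = {1, 2}"
  proof
    show "(\<Union>u\<in>{u. (v, u) \<in> parcs X}. f u) \<subseteq> {1, 2}"
      using assms(2) pair_graph_arc_verts(2)[OF assms(1)] by blast
    show "{1, 2} \<subseteq> (\<Union>u\<in>{u. (v, u) \<in> parcs X}. f u)"
      using assms(3)[OF v] by blast
  qed
qed (use assms(2) in auto)

lemma two_rainbow_dominatingD:
  assumes "two_rainbow_dominating X f" "v \<in> pverts X" "f v = {}" "k \<in> {1, 2}"
  shows "\<exists>u. (v, u) \<in> parcs X \<and> k \<in> f u"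
proof -
  have "(\<Union>u\<in>neighbourhood X v. f u) = {1, 2}"
    using assms by (auto simp: two_rainbow_dominating_def)
  then have "k \<in> (\<Union>u\<in>neighbourhood X v. f u)" using assms(4) by simp
  then show ?thesis by (auto simp: neighbourhood_def)
qed

lemma two_rainbow_dominating_subset:
  "\<lbrakk>two_rainbow_dominating X f; v \<in> pverts X\<rbrakk> \<Longrightarrow> f v \<subseteq> {1, 2}"
  by (simp add: two_rainbow_dominating_def)

lemma subset_labels_cases:
  assumes "S \<subseteq> {1, 2 :: nat}"
  shows "S = {} \<or> S = {1} \<or> S = {2} \<or> S = {1, 2}"
proof -
  have "S \<in> Pow {1, 2}" using assms by blast
  then show ?thesis unfolding Pow_insert Pow_empty by blast
qed

section \<open>From layer weights to dominating couples\<close>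

text \<open>Among layers of weight at least 2, only those in \<open>T l\<close> with
  \<open>l \<noteq> k\<close> are left out of the couple. They do not carry \<open>k\<close>, and
  all their neighbours have weight at most 1, so neither of the two ways in which a vertex outside
  \<open>B\<close> finds its neighbour relies on them.\<close>

lemma dominating_couple_of_layers:
  fixes w :: "'a \<Rightarrow> nat" and L :: "'a \<Rightarrow> nat set"
  assumes G: "pair_graph G" and k: "k \<in> {1, 2}"
    and w0: "\<And>g. w g = 0 \<Longrightarrow> L g = {}"
    and w1: "\<And>g. \<lbrakk>g \<in> pverts G; w g = 1\<rbrakk> \<Longrightarrow> L g = {1} \<or> L g = {2}"
    and ex: "\<And>g. g \<in> pverts G \<Longrightarrow>
      (\<exists>y. (g, y) \<in> parcs G \<and> k \<in> L y) \<or> 3 \<le> w g \<or> (w g = 2 \<and> L g = {k})"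
  defines "T l \<equiv> {g \<in> pverts G. w g = 2 \<and> L g = {l} \<and> (\<forall>y. (g, y) \<in> parcs G \<longrightarrow> w y \<le> 1)}"
  shows "dominating_couple G
     ({g \<in> pverts G. w g = 1 \<and> L g = {k}} \<union> ({g \<in> pverts G. w g = 2} - (T 1 \<union> T 2)))
     ({g \<in> pverts G. 3 \<le> w g} \<union> T k)" (is "dominating_couple G ?A ?B")
  unfolding dominating_couple_def
proof (intro conjI ballI)
  fix x assume x: "x \<in> pverts G - ?B"
  have "\<exists>y. (x, y) \<in> parcs G \<and> y \<in> ?A \<union> ?B"
  proof (cases "\<exists>y. (x, y) \<in> parcs G \<and> k \<in> L y")
    case True
    then obtain y where y: "(x, y) \<in> parcs G" "k \<in> L y" by blast
    have yV: "y \<in> pverts G" using pair_graph_arc_verts[OF G y(1)] by simp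
    have "w y \<noteq> 0" using w0 y by force
    then consider "w y = 1" | "w y = 2" | "w y \<ge> 3" by linarith
    then have "y \<in> ?A \<union> ?B"
    proof cases
      case 1
      have "L y = {k}" using w1[OF yV 1] y(2) by (metis singletonD)
      then show ?thesis using 1 yV by blast
    next
      case 2
      \<comment> \<open>A weight 2 layer that carries \<open>k\<close> can only be exceptional for
        \<open>k\<close> itself, and then it lies in \<open>B\<close>.\<close>
      have "l = k" if "y \<in> T l" for l using that y(2) by (simp add: T_def)
      then have "y \<notin> T 1 \<union> T 2 \<or> y \<in> T k" by blast
      then show ?thesis using 2 yV by blast
    qed (use yV in auto)
    then show ?thesis using y by blast
  next
    case False
    then have x2: "w x = 2" "L x = {k}" using ex[of x] x by auto
    \<comment> \<open>Since \<open>x\<close> is not in \<open>T k\<close>, the only condition of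
      \<open>T k\<close> it can violate is the bound on its neighbours.\<close>
    then obtain y where y: "(x, y) \<in> parcs G" "w y > 1"
      using x by (force simp: T_def not_le)
    have yV: "y \<in> pverts G" using pair_graph_arc_verts[OF G y(1)] by simp
    have "(y, x) \<in> parcs G" using pair_graph_arc_sym[OF G y(1)] .
    \<comment> \<open>The neighbour \<open>x\<close> of \<open>y\<close> has weight 2, which is too
      much for \<open>y\<close> to be exceptional.\<close>
    then have "y \<notin> T l" for l using x2 by (auto simp: T_def)
    then have "y \<in> ?A \<union> ?B" using y yV by auto
    then show ?thesis using y by blast
  qed
  then obtain y where y: "(x, y) \<in> parcs G" "y \<in> ?A \<union> ?B" by blast
  have "x \<in> neighbourhood G y"
    using pair_graph_arc_sym[OF G y(1)] by (simp add: neighbourhood_def)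
  then show "\<exists>w\<in>?A \<union> ?B. x \<in> neighbourhood G w" using y(2) by (rule bexI)
next
  show "?A \<subseteq> pverts G" by blast
  show "?B \<subseteq> pverts G" unfolding T_def by blast
  have "T k \<subseteq> T 1 \<union> T 2" using k by blast
  moreover have "w g = 2" if "g \<in> T k" for g using that unfolding T_def by blast
  ultimately show "?A \<inter> ?B = {}" by fastforce
qed

text \<open>Distributes the cost over the vertices, so that it can be compared with the weight of a
  function layer by layer.\<close>

lemma couple_cost_eq_sum:
  assumes "finite V" "A \<subseteq> V" "B \<subseteq> V"
  shows "2 * card A + 3 * card B = (\<Sum>g\<in>V. (if g \<in> A then 2 else 0) + (if g \<in> B then 3 else 0))"
  using assms by (simp add: sum.distrib sum.If_cases Int_absorb1)

lemma couple_le_layer_weights: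
  fixes w :: "'a \<Rightarrow> nat" and L :: "'a \<Rightarrow> nat set"
  assumes G: "pair_graph G"
    and w0: "\<And>g. w g = 0 \<Longrightarrow> L g = {}"
    and w1: "\<And>g. \<lbrakk>g \<in> pverts G; w g = 1\<rbrakk> \<Longrightarrow> L g = {1} \<or> L g = {2}"
    and ex: "\<And>g k. \<lbrakk>g \<in> pverts G; k \<in> {1, 2}\<rbrakk> \<Longrightarrow>
      (\<exists>y. (g, y) \<in> parcs G \<and> k \<in> L y) \<or> 3 \<le> w g \<or> (w g = 2 \<and> L g = {k})"
  obtains A B where "dominating_couple G A B" "2 * card A + 3 * card B \<le> (\<Sum>g\<in>pverts G. w g)"
proof -
  define T where
    "T l = {g \<in> pverts G. w g = 2 \<and> L g = {l} \<and> (\<forall>y. (g, y) \<in> parcs G \<longrightarrow> w y \<le> 1)}" for l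
  define A where
    "A k = {g \<in> pverts G. w g = 1 \<and> L g = {k}} \<union> ({g \<in> pverts G. w g = 2} - (T 1 \<union> T 2))" for k
  define B where "B k = {g \<in> pverts G. 3 \<le> w g} \<union> T k" for k
  define cost where "cost k = 2 * card (A k) + 3 * card (B k)" for k
  have dom: "dominating_couple G (A k) (B k)" if "k \<in> {1, 2}" for k
    unfolding A_def B_def T_def
    by (rule dominating_couple_of_layers[OF G that w0 w1]) (use ex[OF _ that] in auto)
  let ?c = "\<lambda>k g. (if g \<in> A k then 2 else 0) + (if g \<in> B k then 3 else (0::nat))"
  have cost: "cost k = (\<Sum>g\<in>pverts G. ?c k g)" for k
    unfolding cost_def
    by (rule couple_cost_eq_sum[OF pair_graph_finite_verts[OF G]])
      (auto simp: A_def B_def T_def)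
  \<comment> \<open>By weight: a layer of weight 1 is paid for in one couple only (2 in total);
    weight 2 costs 2 + 2, or 3 + 0 if exceptional, since \<open>T 1\<close> and \<open>T 2\<close>
    are disjoint; weight at least 3 costs 3 + 3.\<close>
  have "?c 1 g + ?c 2 g \<le> 2 * w g" if g: "g \<in> pverts G" for g
  proof -
    consider "w g = 0" | "w g = 1" | "w g = 2" | "w g \<ge> 3" by linarith
    then show ?thesis
    proof cases
      case 2
      then show ?thesis using w1[OF g] by (auto simp: A_def B_def T_def)
    qed (auto simp: A_def B_def T_def)
  qed
  then have "cost 1 + cost 2 \<le> 2 * (\<Sum>g\<in>pverts G. w g)"
    unfolding cost sum.distrib[symmetric] sum_distrib_left by (rule sum_mono)
  then have "cost 1 \<le> (\<Sum>g\<in>pverts G. w g) \<or> cost 2 \<le> (\<Sum>g\<in>pverts G. w g)" by linarith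
  then show ?thesis using that dom unfolding cost_def by blast
qed

lemma rainbow_weight_lex_product:
  "rainbow_weight (lex_product G H) f = (\<Sum>g\<in>pverts G. rainbow_weight H (\<lambda>h. f (g, h)))"
  by (simp add: rainbow_weight_def lex_product_def sum.cartesian_product)

section \<open>Functions of small weight on \<open>H\<close>\<close>

locale rainbow_three_graph =
  fixes H :: "'b pair_pre_digraph"
  assumes H: "pair_graph H"
    and number: "two_rainbow_domination_number H = 3"
    and no_pair: "\<And>\<phi> h. \<lbrakk>two_rainbow_dominating H \<phi>;
           rainbow_weight H \<phi> = two_rainbow_domination_number H; h \<in> pverts H\<rbrakk>
         \<Longrightarrow> \<phi> h \<noteq> {1, 2}"
begin

lemma finite_verts: "finite (pverts H)"
  using pair_graph_finite_verts[OF H] .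

lemma verts_nonempty: "pverts H \<noteq> {}"
proof
  assume e: "pverts H = {}"
  have "two_rainbow_dominating H (\<lambda>_. {})" by (simp add: two_rainbow_dominating_def e)
  from two_rainbow_domination_number_le[OF H this] show False
    by (simp add: rainbow_weight_def e number)
qed

text \<open>A layer over \<open>B\<close> must supply both labels to neighbouring layers, so the
  minimum function has to use both. It does if some vertex is empty; otherwise \<open>H\<close> has
  exactly three vertices and can be relabelled freely.\<close>

lemma two_rainbow_dominating_weight_three:
  obtains \<phi> where "two_rainbow_dominating H \<phi>" "rainbow_weight H \<phi> = 3"
    "\<And>k. k \<in> {1, 2} \<Longrightarrow> \<exists>h\<in>pverts H. k \<in> \<phi> h"
proof -
  obtain \<phi> where \<phi>: "two_rainbow_dominating H \<phi>" "rainbow_weight H \<phi> = 3"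
    using two_rainbow_domination_number_attained[OF H] number by metis
  show ?thesis
  proof (cases "\<exists>v\<in>pverts H. \<phi> v = {}")
    case True
    then obtain v where "v \<in> pverts H" "\<phi> v = {}" by blast
    then show ?thesis
      using that[OF \<phi>] two_rainbow_dominatingD[OF \<phi>(1)] pair_graph_arc_verts(2)[OF H] by blast
  next
    case False
    have "card (\<phi> v) = 1" if v: "v \<in> pverts H" for v
    proof -
      have "\<phi> v \<noteq> {}" "\<phi> v \<noteq> {1, 2}" "\<phi> v \<subseteq> {1, 2}"
        using False v no_pair[OF \<phi>(1)] \<phi> number two_rainbow_dominating_subset[OF \<phi>(1)] by auto
      then have "\<phi> v = {1} \<or> \<phi> v = {2}" using subset_labels_cases by blast
      then show ?thesis by (elim disjE) simp_all
    qed
    then have card3: "card (pverts H) = 3" using \<phi>(2) by (simp add: rainbow_weight_def)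
    then obtain a b where ab: "a \<in> pverts H" "b \<in> pverts H" "a \<noteq> b"
      by (auto simp: numeral_3_eq_3 card_Suc_eq)
    \<comment> \<open>With no empty vertex nothing has to be dominated, so any assignment of single
      labels has weight 3; this one uses both.\<close>
    let ?\<psi> = "\<lambda>v. if v = a then {1} else {2::nat}"
    have "two_rainbow_dominating H ?\<psi>" by (simp add: two_rainbow_dominating_def)
    moreover have "rainbow_weight H ?\<psi> = 3"
      using card3 by (simp add: rainbow_weight_def if_distrib[of card] cong: if_cong)
    moreover have "\<exists>h\<in>pverts H. k \<in> ?\<psi> h" if "k \<in> {1, 2}" for k
    proof (cases "k = 1")
      case True
      then show ?thesis using ab(1) by (intro bexI[of _ a]) simp_all
    next
      case False
      then show ?thesis using ab(2,3) that by (intro bexI[of _ b]) simp_all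
    qed
    ultimately show ?thesis by (rule that)
  qed
qed

text \<open>Applied to a layer that receives no label \<open>k\<close> from outside. If
  \<open>k\<close> occurs at two vertices, counting labels suffices. If it occurs at most once,
  adding labels at a single vertex gives a 2-rainbow dominating function with a vertex labelled
  \<open>{1, 2}\<close>, which cannot have weight 3.\<close>

lemma partial_domination_weight:
  assumes sub: "\<And>h. h \<in> pverts H \<Longrightarrow> \<phi> h \<subseteq> {1, 2}" and k: "k \<in> {1, 2}"
    and dom: "\<And>h. \<lbrakk>h \<in> pverts H; \<phi> h = {}\<rbrakk> \<Longrightarrow> \<exists>u. (h, u) \<in> parcs H \<and> k \<in> \<phi> u"
  shows "3 \<le> rainbow_weight H \<phi> \<or> (rainbow_weight H \<phi> = 2 \<and> (\<Union>h\<in>pverts H. \<phi> h) = {k})"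
proof (cases "\<exists>a\<in>pverts H. \<exists>b\<in>pverts H. a \<noteq> b \<and> k \<in> \<phi> a \<and> k \<in> \<phi> b")
  case True
  then obtain a b where ab: "a \<in> pverts H" "b \<in> pverts H" "a \<noteq> b" "k \<in> \<phi> a" "k \<in> \<phi> b" by blast
  have fin: "finite (\<phi> h)" if "h \<in> pverts H" for h
    using sub[OF that] finite_subset by blast
  show ?thesis
  proof (cases "(\<Union>h\<in>pverts H. \<phi> h) = {k}")
    case True
    have "1 \<le> card (\<phi> a)" "1 \<le> card (\<phi> b)"
      using ab fin by (auto simp: Suc_le_eq card_gt_0_iff)
    moreover have "sum (\<lambda>h. card (\<phi> h)) {a, b} \<le> rainbow_weight H \<phi>"
      unfolding rainbow_weight_def by (rule sum_mono2[OF finite_verts]) (use ab in auto)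
    ultimately have "2 \<le> rainbow_weight H \<phi>" using ab by simp
    then show ?thesis using True by linarith
  next
    case False
    then obtain c l where c: "c \<in> pverts H" "l \<in> \<phi> c" "l \<noteq> k" using ab by blast
    \<comment> \<open>The weight counts the pairs of a vertex and a label on it; three of them are
      exhibited, distinct even if \<open>c\<close> is \<open>a\<close> or \<open>b\<close>.\<close>
    have "{(a, k), (b, k), (c, l)} \<subseteq> Sigma (pverts H) \<phi>" using ab c by auto
    then have "card {(a, k), (b, k), (c, l)} \<le> card (Sigma (pverts H) \<phi>)"
      by (rule card_mono[rotated]) (use fin finite_verts in auto)
    moreover have "card {(a, k), (b, k), (c, l)} = 3" using ab c by simp
    moreover have "card (Sigma (pverts H) \<phi>) = rainbow_weight H \<phi>"
      unfolding rainbow_weight_def using card_SigmaI[OF finite_verts] fin by blast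
    ultimately show ?thesis by simp
  qed
next
  case False
  obtain s where s: "s \<in> pverts H" "\<phi> s \<noteq> {}" "\<And>h. \<lbrakk>h \<in> pverts H; k \<in> \<phi> h\<rbrakk> \<Longrightarrow> h = s"
  proof (cases "\<exists>s\<in>pverts H. k \<in> \<phi> s")
    case True
    then show ?thesis using that False by blast
  next
    case no: False
    \<comment> \<open>If \<open>k\<close> does not occur, no vertex is empty, so any vertex serves
      as \<open>s\<close>.\<close>
    obtain s where "s \<in> pverts H" using verts_nonempty by blast
    moreover from this have "\<phi> s \<noteq> {}" using dom no pair_graph_arc_verts(2)[OF H] by blast
    ultimately show ?thesis using that no by blast
  qed
  \<comment> \<open>Every empty vertex is adjacent to \<open>s\<close>, the only possible carrier of
    \<open>k\<close>, and now sees both labels. As \<open>\<phi> s\<close> was nonempty, the weight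
    grows by at most 1.\<close>
  let ?\<psi> = "\<phi>(s := {1, 2})"
  have \<psi>: "two_rainbow_dominating H ?\<psi>"
  proof (rule two_rainbow_dominatingI[OF H])
    fix v l assume v: "v \<in> pverts H" "?\<psi> v = {}" and l: "l \<in> {1::nat, 2}"
    then have "v \<noteq> s" "\<phi> v = {}" by (auto split: if_splits)
    then obtain u where "(v, u) \<in> parcs H" "k \<in> \<phi> u" using dom v by blast
    moreover from this have "u = s" using s(3) pair_graph_arc_verts(2)[OF H] by blast
    ultimately show "\<exists>u. (v, u) \<in> parcs H \<and> l \<in> ?\<psi> u" using l by auto
  qed (use sub in auto)
  have "finite (\<phi> s)" using sub[OF s(1)] finite_subset by blast
  then have "1 \<le> card (\<phi> s)" using s(2) by (simp add: Suc_le_eq card_gt_0_iff)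
  moreover have "rainbow_weight H \<phi> = card (\<phi> s) + (\<Sum>h\<in>pverts H - {s}. card (\<phi> h))"
    unfolding rainbow_weight_def by (rule sum.remove[OF finite_verts s(1)])
  moreover have "rainbow_weight H ?\<psi> = card (?\<psi> s) + (\<Sum>h\<in>pverts H - {s}. card (?\<psi> h))"
    unfolding rainbow_weight_def by (rule sum.remove[OF finite_verts s(1)])
  ultimately have "rainbow_weight H ?\<psi> \<le> rainbow_weight H \<phi> + 1" by simp
  \<comment> \<open>Weight 3 would make this a minimum function with the value \<open>{1, 2}\<close>
    at \<open>s\<close>. So its weight is at least 4, and that of \<open>\<phi>\<close> at least
    3.\<close>
  moreover have "rainbow_weight H ?\<psi> \<noteq> 3" using no_pair[OF \<psi> _ s(1)] number by auto
  moreover have "3 \<le> rainbow_weight H ?\<psi>"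
    using two_rainbow_domination_number_le[OF H \<psi>] number by simp
  ultimately show ?thesis by linarith
qed

section \<open>The lower and the upper bound for the product\<close>

lemma couple_le_rainbow_weight:
  assumes G: "pair_graph G" and f: "two_rainbow_dominating (lex_product G H) f"
  obtains A B where "dominating_couple G A B"
    "2 * card A + 3 * card B \<le> rainbow_weight (lex_product G H) f"
proof -
  \<comment> \<open>The defaults outside \<open>G\<close> make weight 0 imply an empty label set for
    every \<open>g\<close>, as the lemma on layer weights demands.\<close>
  define w where "w g = (if g \<in> pverts G then rainbow_weight H (\<lambda>h. f (g, h)) else 0)" for g
  define L where "L g = (if g \<in> pverts G then \<Union>h\<in>pverts H. f (g, h) else {})" for g
  have sub: "f (g, h) \<subseteq> {1, 2}" if "g \<in> pverts G" "h \<in> pverts H" for g h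
    using two_rainbow_dominating_subset[OF f] that by (simp add: lex_product_def)
  have fin: "finite (f (g, h))" if "g \<in> pverts G" "h \<in> pverts H" for g h
    using sub[OF that] finite_subset by blast
  have card_L: "card (L g) \<le> w g" for g
    using card_UN_le[OF finite_verts, of "\<lambda>h. f (g, h)"]
    by (simp add: L_def w_def rainbow_weight_def)
  have L_sub: "L g \<subseteq> {1, 2}" for g using sub by (auto simp: L_def)
  then have fin_L: "finite (L g)" for g using finite_subset by blast
  show ?thesis
  proof (rule couple_le_layer_weights[OF G])
    fix g assume "w g = 0"
    then show "L g = {}" using card_L[of g] fin_L by auto
  next
    fix g assume g: "g \<in> pverts G" "w g = 1"
    have "L g \<noteq> {}"
    proof
      assume "L g = {}"
      then have "w g = 0" using g by (auto simp: L_def w_def rainbow_weight_def)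
      then show False using g by simp
    qed
    moreover have "L g \<noteq> {1, 2}" using card_L[of g] g by auto
    ultimately show "L g = {1} \<or> L g = {2}" using subset_labels_cases[OF L_sub[of g]] by blast
  next
    fix g and k :: nat assume g: "g \<in> pverts G" and k: "k \<in> {1, 2}"
    show "(\<exists>y. (g, y) \<in> parcs G \<and> k \<in> L y) \<or> 3 \<le> w g \<or> (w g = 2 \<and> L g = {k})"
    proof (rule disj_imp[THEN iffD2, OF impI])
      assume no: "\<not> (\<exists>y. (g, y) \<in> parcs G \<and> k \<in> L y)"
      have "3 \<le> rainbow_weight H (\<lambda>h. f (g, h)) \<or>
        (rainbow_weight H (\<lambda>h. f (g, h)) = 2 \<and> (\<Union>h\<in>pverts H. f (g, h)) = {k})"
      proof (rule partial_domination_weight[OF sub[OF g] k])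
        fix h assume h: "h \<in> pverts H" "f (g, h) = {}"
        then have "(g, h) \<in> pverts (lex_product G H)" using g by (simp add: lex_product_def)
        from two_rainbow_dominatingD[OF f this h(2) k]
        obtain g' h' where gh: "((g, h), (g', h')) \<in> parcs (lex_product G H)" "k \<in> f (g', h')"
          by auto
        \<comment> \<open>The dominating neighbour carries \<open>k\<close>, so it cannot lie in a
          neighbouring layer and must lie in the layer over \<open>g\<close>.\<close>
        then have "(g, g') \<notin> parcs G" using no by (auto simp: lex_product_def L_def)
        then show "\<exists>u. (h, u) \<in> parcs H \<and> k \<in> f (g, u)"
          using gh by (auto simp: lex_product_def)
      qed
      then show "3 \<le> w g \<or> (w g = 2 \<and> L g = {k})" using g by (simp add: w_def L_def)
    qed
  next
    fix A B assume AB: "dominating_couple G A B" "2 * card A + 3 * card B \<le> sum w (pverts G)"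
    have "sum w (pverts G) = rainbow_weight (lex_product G H) f"
      unfolding rainbow_weight_lex_product by (rule sum.cong) (auto simp: w_def)
    then show thesis using that AB by simp
  qed
qed

lemma rainbow_weight_le_couple:
  assumes G: "pair_graph G" and AB: "dominating_couple G A B"
  obtains f where "two_rainbow_dominating (lex_product G H) f"
    "rainbow_weight (lex_product G H) f = 2 * card A + 3 * card B"
proof -
  obtain \<phi> where \<phi>: "two_rainbow_dominating H \<phi>" "rainbow_weight H \<phi> = 3"
    "\<And>k. k \<in> {1, 2} \<Longrightarrow> \<exists>h\<in>pverts H. k \<in> \<phi> h"
    using two_rainbow_dominating_weight_three by blast
  obtain h0 where h0: "h0 \<in> pverts H" using verts_nonempty by blast
  have V: "A \<subseteq> pverts G" "B \<subseteq> pverts G" "A \<inter> B = {}"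
    using AB by (auto simp: dominating_couple_def)
  define f where "f = (\<lambda>(g, h). if g \<in> B then \<phi> h
      else if g \<in> A \<and> h = h0 then {1, 2::nat} else {})"
  have "two_rainbow_dominating (lex_product G H) f"
  proof (rule two_rainbow_dominatingI[OF pair_graph_lex_product[OF G H]])
    fix v assume "v \<in> pverts (lex_product G H)"
    then show "f v \<subseteq> {1, 2}"
      using two_rainbow_dominating_subset[OF \<phi>(1)]
      by (cases v) (simp add: f_def lex_product_def)
  next
    fix v and k :: nat
    assume v: "v \<in> pverts (lex_product G H)" "f v = {}" and k: "k \<in> {1, 2}"
    obtain g h where gh: "v = (g, h)" "g \<in> pverts G" "h \<in> pverts H"
      using v by (auto simp: lex_product_def)
    show "\<exists>u. (v, u) \<in> parcs (lex_product G H) \<and> k \<in> f u"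
    proof (cases "g \<in> B")
      case True
      then obtain u where u: "(h, u) \<in> parcs H" "k \<in> \<phi> u"
        using two_rainbow_dominatingD[OF \<phi>(1) gh(3) _ k] v gh by (auto simp: f_def)
      then have "((g, h), (g, u)) \<in> parcs (lex_product G H)" "k \<in> f (g, u)"
        using True gh pair_graph_arc_verts[OF H u(1)] by (auto simp: lex_product_def f_def)
      then show ?thesis using gh by blast
    next
      case False
      \<comment> \<open>The couple condition also covers vertices of \<open>A\<close>. Every vertex
        of the layer over \<open>g\<close> is adjacent to all of the layer over \<open>y\<close>,
        which carries both labels: at \<open>h0\<close> if \<open>y\<close> is in \<open>A\<close>,
        by the choice of \<open>\<phi>\<close> if \<open>y\<close> is in \<open>B\<close>.\<close>
      then have "\<exists>y\<in>A \<union> B. (y, g) \<in> parcs G"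
        using AB gh(2) unfolding dominating_couple_def neighbourhood_def by blast
      then obtain y where y: "y \<in> A \<union> B" "(y, g) \<in> parcs G" by blast
      obtain h' where "h' \<in> pverts H" "k \<in> f (y, h')"
        using y V \<phi>(3)[OF k] k h0 by (cases "y \<in> B") (auto simp: f_def)
      then have "((g, h), (y, h')) \<in> parcs (lex_product G H)" "k \<in> f (y, h')"
        using gh pair_graph_arc_verts[OF G y(2)] pair_graph_arc_sym[OF G y(2)]
        by (auto simp: lex_product_def)
      then show ?thesis using gh by blast
    qed
  qed
  moreover have "rainbow_weight H (\<lambda>h. f (g, h)) =
      (if g \<in> A then 2 else 0) + (if g \<in> B then 3 else 0)" for g
  proof (cases "g \<in> B")
    case True
    then show ?thesis using \<phi>(2) V by (auto simp: f_def)
  next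
    case False
    then have "rainbow_weight H (\<lambda>h. f (g, h)) =
        (\<Sum>h\<in>pverts H. if h = h0 then if g \<in> A then 2 else 0 else 0)"
      unfolding rainbow_weight_def by (intro sum.cong) (auto simp: f_def)
    then show ?thesis using False h0 finite_verts by simp
  qed
  then have "rainbow_weight (lex_product G H) f = 2 * card A + 3 * card B"
    unfolding rainbow_weight_lex_product
      couple_cost_eq_sum[OF pair_graph_finite_verts[OF G] V(1,2)] by simp
  ultimately show ?thesis using that by blast
qed

end

theorem theorem13:
  fixes G :: "'a pair_pre_digraph" and H :: "'b pair_pre_digraph"
  assumes "pair_graph G" and "pair_graph H"
    and "Digraph_Component.connected (with_proj H)"
    and "two_rainbow_domination_number H = 3"
    and "\<And>\<phi> h. \<lbrakk>two_rainbow_dominating H \<phi>;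
           rainbow_weight H \<phi> = two_rainbow_domination_number H; h \<in> pverts H\<rbrakk>
         \<Longrightarrow> \<phi> h \<noteq> {1, 2}"
  shows "two_rainbow_domination_number (lex_product G H) =
    Min {2 * card A + 3 * card B |A B. dominating_couple G A B}"
proof (rule antisym)
  note G = \<open>pair_graph G\<close>
  note fin = finite_couple_costs[OF pair_graph_finite_verts[OF G]]
  note GH = pair_graph_lex_product[OF G \<open>pair_graph H\<close>]
  interpret rainbow_three_graph H
    using assms by (intro rainbow_three_graph.intro)
  obtain A B where AB: "dominating_couple G A B"
    and Min: "Min {2 * card A + 3 * card B |A B. dominating_couple G A B} = 2 * card A + 3 * card B"
    using Min_in[OF fin couple_costs_nonempty] by blast
  obtain f where "two_rainbow_dominating (lex_product G H) f"
    "rainbow_weight (lex_product G H) f = 2 * card A + 3 * card B"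
    using rainbow_weight_le_couple[OF G AB] .
  then show "two_rainbow_domination_number (lex_product G H) \<le>
      Min {2 * card A + 3 * card B |A B. dominating_couple G A B}"
    using two_rainbow_domination_number_le[OF GH, of f] Min by simp
next
  note G = \<open>pair_graph G\<close>
  interpret rainbow_three_graph H
    using assms by (intro rainbow_three_graph.intro)
  obtain f where f: "two_rainbow_dominating (lex_product G H) f"
    "rainbow_weight (lex_product G H) f = two_rainbow_domination_number (lex_product G H)"
    using two_rainbow_domination_number_attained[OF pair_graph_lex_product[OF G H]] .
  obtain A B where AB: "dominating_couple G A B"
    "2 * card A + 3 * card B \<le> rainbow_weight (lex_product G H) f"
    using couple_le_rainbow_weight[OF G f(1)] .
  have "Min {2 * card A + 3 * card B |A B. dominating_couple G A B} \<le> 2 * card A + 3 * card B"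
    by (rule Min_le[OF finite_couple_costs[OF pair_graph_finite_verts[OF G]]]) (use AB(1) in blast)
  also have "\<dots> \<le> two_rainbow_domination_number (lex_product G H)"
    using AB(2) f(2) by simp
  finally show "Min {2 * card A + 3 * card B |A B. dominating_couple G A B} \<le>
      two_rainbow_domination_number (lex_product G H)" .
qed

end
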